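(* Let $M$ be a real $5$-dimensional manifold endowed with a Lorentzian metric $g$ of signature $(-++++)$. Let $T_{ab}$ be a real second order symmetric tensor at a point $p\in M$, and let $T^a{}_b=g^{ac}T_{cb}$ be its mixed form, regarded as a linear operator $T_p(M)\to T_p(M)$. Then: 1. There always exists a $2$-dimensional spacelike subspace of $T_p(M)$ invariant under $T^a{}_b$. 2. If a non-null subspace $\mathcal{V}$ of $T_p(M)$ is invariant under $T^a{}_b$, then so is its orthogonal complement $\mathcal{V}^{\perp}$. 3. There always exists a $3$-dimensional timelike subspace of $T_p(M)$ invariant under $T^a{}_b$. 4. For each $r\in\{2,3,4\}$, $T^a{}_b$ admits an $r$-dimensional null invariant subspace $\mathcal{N}$ of $T_p(M)$ if and only if $T^a{}_b$ has a null eigenvector; moreover every such $\mathcal{N}$ contains a null eigenvector of $T^a{}_b$.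
   Context: A nonzero real vector $v\in T_p(M)$ is timelike, null or spacelike according as $g(v,v)<0$, $=0$ or $>0$; null eigenvectors are understood to be real vectors of $T_p(M)$. An $r$-dimensional subspace of $T_p(M)$ with $r\ge 2$ is called timelike, null or spacelike according as it contains more than one, exactly one, or no linearly independent null vectors (i.e. more than one, exactly one, or no null directions). A one-dimensional subspace is called timelike, null or spacelike according to the character of a vector spanning it. A subspace is non-null if it is timelike or spacelike. A subspace $\mathcal{W}$ is invariant under $T^a{}_b$ if $T^a{}_b w^b\in\mathcal{W}$ for all $w\in\mathcal{W}$. Orthogonal complements are with respect to $g$. *)

theory Defs
  imports "HOL-Analysis.Analysis"
begin

text \<open>
  Everything takes place in a single tangent space, modelled by a type \<open>'v\<close> of class
  \<open>real_vector\<close>.  It carries no structure other than its linear one; the metric is the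
  bilinear form \<open>g\<close>, which is unrelated to any inner product of the library.
\<close>

definition symmetric_form :: "('v::real_vector \<Rightarrow> 'v \<Rightarrow> real) \<Rightarrow> bool" where
  "symmetric_form T \<longleftrightarrow> bilinear T \<and> (\<forall>u v. T u v = T v u)"

text \<open>Signature \<open>(-+...+)\<close>: there is a basis in which \<open>g\<close> is \<open>diag(-1,1,...,1)\<close>.\<close>

definition lorentzian :: "('v::real_vector \<Rightarrow> 'v \<Rightarrow> real) \<Rightarrow> bool" where
  "lorentzian g \<longleftrightarrow> symmetric_form g \<and>
     (\<exists>t B. t \<notin> B \<and> independent (insert t B) \<and> span (insert t B) = UNIV \<and>
        g t t = - 1 \<and> (\<forall>x\<in>B. g x x = 1) \<and>
        (\<forall>x\<in>insert t B. \<forall>y\<in>insert t B. x \<noteq> y \<longrightarrow> g x y = 0))"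

text \<open>
  Lowering an index maps \<open>w\<close> to the covector \<open>g(-, w)\<close>; raising is the inverse map, given by
  the inverse metric.  Covectors are plain functions here, so \<open>raise_index\<close> is meaningful
  only on linear functionals, which for nondegenerate \<open>g\<close> in finite dimension are exactly
  the range of \<open>lower_index\<close>.
\<close>

definition lower_index :: "('v::real_vector \<Rightarrow> 'v \<Rightarrow> real) \<Rightarrow> 'v \<Rightarrow> ('v \<Rightarrow> real)" where
  "lower_index g w = (\<lambda>u. g u w)"

definition raise_index :: "('v::real_vector \<Rightarrow> 'v \<Rightarrow> real) \<Rightarrow> ('v \<Rightarrow> real) \<Rightarrow> 'v" where
  "raise_index g = inv (lower_index g)"

text \<open>\<open>T\<^sup>a\<^sub>b v\<^sup>b = g\<^sup>a\<^sup>c T\<^sub>c\<^sub>b v\<^sup>b\<close>\<close>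

definition mixed_form ::
    "('v::real_vector \<Rightarrow> 'v \<Rightarrow> real) \<Rightarrow> ('v \<Rightarrow> 'v \<Rightarrow> real) \<Rightarrow> 'v \<Rightarrow> 'v" where
  "mixed_form g T v = raise_index g (\<lambda>u. T u v)"

definition timelike_vector :: "('v::real_vector \<Rightarrow> 'v \<Rightarrow> real) \<Rightarrow> 'v \<Rightarrow> bool" where
  "timelike_vector g v \<longleftrightarrow> v \<noteq> 0 \<and> g v v < 0"

definition null_vector :: "('v::real_vector \<Rightarrow> 'v \<Rightarrow> real) \<Rightarrow> 'v \<Rightarrow> bool" where
  "null_vector g v \<longleftrightarrow> v \<noteq> 0 \<and> g v v = 0"

definition spacelike_vector :: "('v::real_vector \<Rightarrow> 'v \<Rightarrow> real) \<Rightarrow> 'v \<Rightarrow> bool" where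
  "spacelike_vector g v \<longleftrightarrow> v \<noteq> 0 \<and> g v v > 0"

definition null_directions :: "('v::real_vector \<Rightarrow> 'v \<Rightarrow> real) \<Rightarrow> 'v set \<Rightarrow> 'v set set" where
  "null_directions g W = {span {v} | v. v \<in> W \<and> null_vector g v}"

text \<open>The zero subspace has no causal character.\<close>

definition timelike_subspace :: "('v::real_vector \<Rightarrow> 'v \<Rightarrow> real) \<Rightarrow> 'v set \<Rightarrow> bool" where
  "timelike_subspace g W \<longleftrightarrow> subspace W \<and>
     ((\<exists>v. W = span {v} \<and> timelike_vector g v) \<or>
      (dim W \<ge> 2 \<and> (\<exists>L\<in>null_directions g W. \<exists>L'\<in>null_directions g W. L \<noteq> L')))"

definition null_subspace :: "('v::real_vector \<Rightarrow> 'v \<Rightarrow> real) \<Rightarrow> 'v set \<Rightarrow> bool" where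
  "null_subspace g W \<longleftrightarrow> subspace W \<and>
     ((\<exists>v. W = span {v} \<and> null_vector g v) \<or>
      (dim W \<ge> 2 \<and> (\<exists>!L. L \<in> null_directions g W)))"

definition spacelike_subspace :: "('v::real_vector \<Rightarrow> 'v \<Rightarrow> real) \<Rightarrow> 'v set \<Rightarrow> bool" where
  "spacelike_subspace g W \<longleftrightarrow> subspace W \<and>
     ((\<exists>v. W = span {v} \<and> spacelike_vector g v) \<or>
      (dim W \<ge> 2 \<and> null_directions g W = {}))"

definition non_null_subspace :: "('v::real_vector \<Rightarrow> 'v \<Rightarrow> real) \<Rightarrow> 'v set \<Rightarrow> bool" where
  "non_null_subspace g W \<longleftrightarrow> timelike_subspace g W \<or> spacelike_subspace g W"

definition invariant_under :: "('v \<Rightarrow> 'v) \<Rightarrow> 'v set \<Rightarrow> bool" where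
  "invariant_under A W \<longleftrightarrow> (\<forall>w\<in>W. A w \<in> W)"

definition g_complement :: "('v::real_vector \<Rightarrow> 'v \<Rightarrow> real) \<Rightarrow> 'v set \<Rightarrow> 'v set" where
  "g_complement g W = {v. \<forall>w\<in>W. g v w = 0}"

definition null_eigenvector ::
    "('v::real_vector \<Rightarrow> 'v \<Rightarrow> real) \<Rightarrow> ('v \<Rightarrow> 'v) \<Rightarrow> 'v \<Rightarrow> bool" where
  "null_eigenvector g A v \<longleftrightarrow> null_vector g v \<and> (\<exists>c::real. A v = c *\<^sub>R v)"

end

theory Submission
  imports Defs "HOL-Computational_Algebra.Fundamental_Theorem_Algebra"
begin

text \<open>
  Write \<open>A\<close> for the mixed form; it is self-adjoint for \<open>g\<close>.  The key fact is that on every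
  invariant subspace \<open>L\<close> of dimension at least 4, \<open>A\<close> has a spacelike eigenvector.  Indeed, factoring
  an annihilating polynomial gives either an eigenvector in \<open>L\<close> or an invariant plane on which
  \<open>(A - a)\<^sup>2 = - b\<^sup>2\<close> with \<open>b \<noteq> 0\<close>.  If this subspace is spacelike we are done; if it is timelike,
  its orthogonal complement is positive definite; and if it is spanned by a null vector \<open>k\<close>, then \<open>A\<close>
  acts on the positive definite quotient of \<open>k\<^sup>\<bottom>\<close> by \<open>k\<close>.  A spacelike eigenvector and another one
  orthogonal to it span the plane of part 1, whose complement is the timelike 3-space of part 3.

  The null direction of a null subspace is orthogonal to the whole subspace, so it is mapped to
  itself by \<open>A\<close> if the subspace is invariant.  Conversely, if \<open>k\<close> is a null eigenvector and \<open>u\<close> is an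
  eigenvector of \<open>A\<close> on \<open>k\<^sup>\<bottom>\<close> modulo \<open>k\<close>, then the span of \<open>u\<close> and \<open>k\<close>, its complement, and \<open>k\<^sup>\<bottom>\<close>
  are null invariant subspaces of dimensions 2, 3 and 4.
\<close>

section \<open>Polynomials in a linear operator\<close>

text \<open>Horner's scheme for p(A) v. Taking \<open>A\<close> to be multiplication by a complex
  number z, and v = 1, evaluates a real polynomial at z.\<close>

definition poly_act :: "('v::real_vector \<Rightarrow> 'v) \<Rightarrow> real poly \<Rightarrow> 'v \<Rightarrow> 'v" where
  "poly_act A p v = fold_coeffs (\<lambda>a w. a *\<^sub>R v + A w) p 0"

lemma poly_act_0 [simp]: "poly_act A 0 v = 0"
  by (simp add: poly_act_def)

lemma poly_act_pCons [simp]: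
  assumes "linear A"
  shows "poly_act A (pCons a p) v = a *\<^sub>R v + A (poly_act A p v)"
  by (cases "a = 0 \<and> p = 0") (auto simp: poly_act_def linear_0[OF assms])

lemma poly_act_add:
  assumes "linear A"
  shows "poly_act A (p + q) v = poly_act A p v + poly_act A q v"
  by (induction p q rule: poly_induct2) (simp_all add: assms linear_add[OF assms] algebra_simps)

lemma poly_act_smult:
  assumes "linear A"
  shows "poly_act A (smult c p) v = c *\<^sub>R poly_act A p v"
  by (induction p) (simp_all add: assms linear_scale[OF assms] algebra_simps)

lemma poly_act_mult:
  assumes "linear A"
  shows "poly_act A (p * q) v = poly_act A p (poly_act A q v)"
  by (induction p) (simp_all add: assms poly_act_add[OF assms] poly_act_smult[OF assms])

lemma poly_act_mem:
  assumes "linear A" "subspace W" "invariant_under A W" "v \<in> W"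
  shows "poly_act A p v \<in> W"
proof (induction p)
  case 0
  then show ?case using assms by (simp add: subspace_0)
next
  case (pCons a p)
  then show ?case using assms
    by (simp add: invariant_under_def subspace_add subspace_scale)
qed

text \<open>Take a complex root z. A real z gives a linear factor. Otherwise divide by the real
  quadratic with roots z and its conjugate: the remainder is real, has degree at most 1 and vanishes
  at the non-real z, so it is zero.\<close>

lemma real_poly_factor:
  fixes p :: "real poly"
  assumes "degree p > 0"
  obtains (linear) a where "[:- a, 1:] dvd p"
    | (quadratic) a b where "b \<noteq> 0" "[:a\<^sup>2 + b\<^sup>2, - 2 * a, 1:] dvd p"
proof -
  have ev: "poly (map_poly complex_of_real q) z = poly_act ((*) z) q 1" for q z
    by (induction q) (simp_all add: map_poly_pCons scaleR_conv_of_real linear_times)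
  have "degree (map_poly complex_of_real p) > 0"
    using assms by (simp add: degree_map_poly)
  then have "\<not> constant (poly (map_poly complex_of_real p))"
    by (simp add: constant_degree)
  then obtain z where "poly (map_poly complex_of_real p) z = 0"
    using fundamental_theorem_of_algebra by blast
  then have z: "poly_act ((*) z) p 1 = 0"
    by (simp add: ev)
  note L = linear_times[of z]
  show thesis
  proof (cases "Im z = 0")
    case True
    have "poly_act ((*) z) q 1 = of_real (poly q (Re z))" for q
      using True by (induction q) (simp_all add: L scaleR_conv_of_real complex_eq_iff)
    with z have "poly p (Re z) = 0"
      by (metis of_real_eq_0_iff)
    then show thesis
      using linear poly_eq_0_iff_dvd by blast
  next
    case False
    define q where "q = [:(Re z)\<^sup>2 + (Im z)\<^sup>2, - 2 * Re z, 1:]"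
    have q0: "poly_act ((*) z) q 1 = 0"
      by (simp add: q_def L complex_eq_iff power2_eq_square algebra_simps)
    have "p = (p div q) * q + p mod q"
      by simp
    then have "poly_act ((*) z) p 1
        = poly_act ((*) z) (p div q) (poly_act ((*) z) q 1) + poly_act ((*) z) (p mod q) 1"
      by (metis poly_act_add[OF L] poly_act_mult[OF L])
    moreover have "poly_act ((*) z) s 0 = 0" for s
      by (induction s) (simp_all add: L)
    ultimately have m: "poly_act ((*) z) (p mod q) 1 = 0"
      using z q0 by simp
    have "degree (p mod q) \<le> 1"
      using degree_mod_less[of q p] by (auto simp: q_def)
    then obtain c d where cd: "p mod q = [:c, d:]"
    proof (cases "degree (p mod q) = 1")
      case True
      then show ?thesis using that by (elim degree1_coeffs)
    next
      case False
      then have "degree (p mod q) = 0" using \<open>degree (p mod q) \<le> 1\<close> by simp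
      then show ?thesis using that[of _ 0] by (elim degree_eq_zeroE) simp
    qed
    \<comment> \<open>These are the real and imaginary parts of c + d z = 0.\<close>
    have "c + d * Re z = 0" "d * Im z = 0"
      using m by (simp_all add: cd L complex_eq_iff)
    then have "p mod q = 0"
      using False by (simp add: cd)
    then show thesis
      using quadratic[OF False] by (simp add: q_def mod_eq_0_iff_dvd)
  qed
qed

text \<open>The iterates of \<open>A\<close> on \<open>v\<close> cannot all be independent in finite
  dimension. The first n of them span the values q(A) v with deg q < n, so a dependency at step n
  gives a polynomial with leading term x^n.\<close>

lemma exists_annihilating_poly:
  fixes A :: "'v::real_vector \<Rightarrow> 'v"
  assumes A: "linear A" and E: "finite E" "span E = (UNIV :: 'v set)"
  obtains p where "p \<noteq> 0" "poly_act A p v = 0"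
proof -
  have sp: "\<exists>p. (p = 0 \<or> degree p < n) \<and> x = poly_act A p v"
    if "x \<in> span ((\<lambda>i. (A ^^ i) v) ` {..<n})" for x n
    using that
  proof (induction rule: span_induct_alt)
    case base
    then show ?case by (metis poly_act_0)
  next
    case (step c x y)
    then obtain i p where i: "i < n" "x = (A ^^ i) v" and p: "p = 0 \<or> degree p < n" "y = poly_act A p v"
      by blast
    have mon: "poly_act A (monom c i) v = c *\<^sub>R (A ^^ i) v"
      by (induction i) (simp_all add: A linear_0[OF A] linear_scale[OF A] monom_0 monom_Suc)
    have "degree (monom c i) < n"
      using i degree_monom_le[of c i] by linarith
    then have "monom c i + p = 0 \<or> degree (monom c i + p) < n"
      using p degree_add_less by auto
    moreover have "c *\<^sub>R x + y = poly_act A (monom c i + p) v"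
      using i p mon by (simp add: poly_act_add[OF A])
    ultimately show ?case by blast
  qed
  have "\<exists>n. (A ^^ n) v \<in> span ((\<lambda>i. (A ^^ i) v) ` {..<n})"
  proof (rule ccontr)
    assume "\<not> ?thesis"
    then have *: "(A ^^ n) v \<notin> span ((\<lambda>i. (A ^^ i) v) ` {..<n})" for n
      by blast
    have "independent ((\<lambda>i. (A ^^ i) v) ` {..<n}) \<and> card ((\<lambda>i. (A ^^ i) v) ` {..<n}) = n" for n
    proof (induction n)
      case 0
      then show ?case by (simp add: independent_empty)
    next
      case (Suc n)
      moreover have "(A ^^ n) v \<notin> (\<lambda>i. (A ^^ i) v) ` {..<n}"
        using *[of n] by (rule contra_subsetD[OF span_superset])
      ultimately show ?case
        using *[of n] by (simp add: lessThan_Suc independent_insert)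
    qed
    then show False
      using real_vector.independent_span_bound[OF E(1), of "(\<lambda>i. (A ^^ i) v) ` {..<Suc (card E)}"] E(2)
      by (simp del: image_Suc_lessThan)
  qed
  then obtain n p where n: "p = 0 \<or> degree p < n" "(A ^^ n) v = poly_act A p v"
    using sp by blast
  have "poly_act A (monom 1 n) v = (A ^^ n) v"
    by (induction n) (simp_all add: A linear_0[OF A] monom_0 monom_Suc)
  then have "poly_act A (monom 1 n + smult (- 1) p) v = 0"
    using n by (simp only: poly_act_add[OF A] poly_act_smult[OF A]) simp
  moreover have "coeff (monom 1 n + smult (- 1) p) n \<noteq> 0"
    using n by (auto simp: coeff_eq_0)
  then have "monom 1 n + smult (- 1) p \<noteq> 0"
    by (metis coeff_0)
  ultimately show thesis
    using that by blast
qed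

text \<open>Working modulo \<open>K\<close> replaces the passage to a quotient space.  A polynomial of least degree
  that maps some vector of \<open>W\<close> outside \<open>K\<close> into \<open>K\<close> must be irreducible.\<close>

lemma eigenvector_or_rotation_mod:
  fixes A :: "'v::real_vector \<Rightarrow> 'v"
  assumes A: "linear A" and E: "finite E" "span E = (UNIV :: 'v set)"
    and W: "subspace W" "invariant_under A W"
    and K: "subspace K"
    and "v \<in> W" "v \<notin> K"
  obtains (eigenvector) u a where "u \<in> W" "u \<notin> K" "A u - a *\<^sub>R u \<in> K"
    | (rotation) u a b where "u \<in> W" "u \<notin> K" "b \<noteq> 0"
        "A (A u) - (2 * a) *\<^sub>R A u + (a\<^sup>2 + b\<^sup>2) *\<^sub>R u \<in> K"
proof -
  define P where "P p \<longleftrightarrow> p \<noteq> 0 \<and> (\<exists>u. u \<in> W \<and> u \<notin> K \<and> poly_act A p u \<in> K)" for p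
  obtain p0 where "p0 \<noteq> 0" "poly_act A p0 v = 0"
    using exists_annihilating_poly[OF A E] .
  then have "P p0"
    using assms by (auto simp: P_def subspace_0)
  then obtain p where p: "P p" and min: "\<And>q. P q \<Longrightarrow> degree p \<le> degree q"
    using arg_min_nat_lemma[of P p0 degree] by blast
  obtain u where u: "u \<in> W" "u \<notin> K" "poly_act A p u \<in> K" and "p \<noteq> 0"
    using p by (auto simp: P_def)
  have "degree p > 0"
  proof (rule ccontr)
    assume "\<not> degree p > 0"
    then obtain c where c: "p = [:c:]"
      using degree_eq_zeroE by blast
    then have "c *\<^sub>R u \<in> K" "c \<noteq> 0"
      using u \<open>p \<noteq> 0\<close> by (simp_all add: A linear_0[OF A])
    then have "inverse c *\<^sub>R (c *\<^sub>R u) \<in> K"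
      using K subspace_scale by blast
    with u \<open>c \<noteq> 0\<close> show False by simp
  qed
  \<comment> \<open>The witness is s(A) u, where s is the cofactor of \<open>q\<close>: its degree
    is below that of \<open>p\<close>, so minimality keeps s(A) u outside \<open>K\<close>, while
    q(A) maps it to p(A) u, which lies in \<open>K\<close>.\<close>
  have red: "\<exists>w. w \<in> W \<and> w \<notin> K \<and> poly_act A q w \<in> K" if q: "q dvd p" "degree q > 0" for q
  proof -
    obtain s where s: "p = q * s"
      using q(1) by (elim dvdE)
    then have "s \<noteq> 0" "q \<noteq> 0" using \<open>p \<noteq> 0\<close> by auto
    then have "degree s < degree p"
      using q(2) by (simp add: s degree_mult_eq)
    then have "\<not> P s" using min by fastforce
    then have "poly_act A s u \<notin> K"
      using u \<open>s \<noteq> 0\<close> by (auto simp: P_def)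
    moreover have "poly_act A q (poly_act A s u) \<in> K"
      using u by (simp add: s poly_act_mult[OF A])
    ultimately show ?thesis
      using poly_act_mem[OF A W \<open>u \<in> W\<close>] by blast
  qed
  from \<open>degree p > 0\<close> show thesis
  proof (cases rule: real_poly_factor)
    case (linear a)
    then obtain w where "w \<in> W" "w \<notin> K" "poly_act A [:- a, 1:] w \<in> K"
      using red by fastforce
    then show thesis
      using eigenvector by (simp add: A linear_0[OF A])
  next
    case (quadratic a b)
    then obtain w where "w \<in> W" "w \<notin> K" "poly_act A [:a\<^sup>2 + b\<^sup>2, - 2 * a, 1:] w \<in> K"
      using red by fastforce
    then show thesis
      using rotation[of w b a] quadratic(1)
      by (simp add: A linear_0[OF A] linear_diff[OF A] linear_scale[OF A] algebra_simps)
  qed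
qed

section \<open>Orthogonal complements and self-adjointness\<close>

lemma g_complement_subspace:
  assumes "bilinear g"
  shows "subspace (g_complement g W)"
  by (auto simp: subspace_def g_complement_def bilinear_lzero[OF assms]
      bilinear_ladd[OF assms] bilinear_lmul[OF assms])

lemma g_complement_span:
  assumes "bilinear g"
  shows "g_complement g (span C) = g_complement g C"
proof -
  have "g v w = 0" if "\<forall>c\<in>C. g v c = 0" "w \<in> span C" for v w
    using that(2)
    by (induction rule: span_induct_alt)
      (use that(1) in \<open>simp_all add: bilinear_rzero[OF assms] bilinear_radd[OF assms] bilinear_rmul[OF assms]\<close>)
  then show ?thesis
    by (auto simp: g_complement_def intro: span_base)
qed

text \<open>The axiom \<open>pos_of_orthogonal\<close> encodes the signature in a form that is meaningful without
  a basis: no plane carries a negative semidefinite \<open>g\<close>.\<close>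

locale lorentz_self_adjoint =
  fixes g :: "'v::real_vector \<Rightarrow> 'v \<Rightarrow> real" and A :: "'v \<Rightarrow> 'v"
  assumes g_bilinear: "bilinear g"
    and g_sym: "g u v = g v u"
    and finite_dim: "\<exists>E. finite E \<and> span E = (UNIV :: 'v set)"
    and timelike_exists: "\<exists>t. g t t < 0"
    and pos_of_orthogonal: "u \<noteq> 0 \<Longrightarrow> g u u \<le> 0 \<Longrightarrow> g u w = 0 \<Longrightarrow> w \<notin> span {u} \<Longrightarrow> g w w > 0"
    and self_adjoint: "g (A u) v = g u (A v)"
begin

lemmas g_simps = bilinear_ladd[OF g_bilinear] bilinear_radd[OF g_bilinear]
  bilinear_lsub[OF g_bilinear] bilinear_rsub[OF g_bilinear]
  bilinear_lmul[OF g_bilinear] bilinear_rmul[OF g_bilinear]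
  bilinear_lzero[OF g_bilinear] bilinear_rzero[OF g_bilinear]

text \<open>A nonzero vector orthogonal to everything is orthogonal to a timelike vector and not a
  multiple of it, hence spacelike; but it is also orthogonal to itself.\<close>

lemma nondegenerate:
  assumes "\<And>u. g u z = 0"
  shows "z = 0"
proof (rule ccontr)
  assume "z \<noteq> 0"
  obtain t where t: "g t t < 0"
    using timelike_exists by blast
  then have "t \<noteq> 0" using g_simps by auto
  moreover have "z \<notin> span {t}"
  proof
    assume "z \<in> span {t}"
    then obtain c where "z = c *\<^sub>R t"
      by (auto simp: span_singleton)
    with assms[of t] t \<open>z \<noteq> 0\<close> show False
      by (simp add: g_simps)
  qed
  ultimately have "g z z > 0"
    using pos_of_orthogonal[of t z] t assms by auto
  then show False using assms by simp
qed

text \<open>Pairing with an arbitrary vector moves \<open>A\<close> to the other argument, where the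
  linearity of \<open>g\<close> applies; nondegeneracy then removes the pairing.\<close>

lemma A_linear: "linear A"
proof (rule linearI)
  fix x y c
  have "A (x + y) - (A x + A y) = 0"
    by (rule nondegenerate) (simp add: g_simps flip: self_adjoint)
  then show "A (x + y) = A x + A y"
    by simp
  have "A (c *\<^sub>R x) - c *\<^sub>R A x = 0"
    by (rule nondegenerate) (simp add: g_simps flip: self_adjoint)
  then show "A (c *\<^sub>R x) = c *\<^sub>R A x"
    by simp
qed

lemmas A_simps = linear_add[OF A_linear] linear_diff[OF A_linear] linear_scale[OF A_linear]
  linear_0[OF A_linear]

lemma complement_invariant:
  assumes "invariant_under A W"
  shows "invariant_under A (g_complement g W)"
  using assms by (auto simp: invariant_under_def g_complement_def self_adjoint)

section \<open>Dimension counts for complements\<close>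

lemma finite_independent:
  fixes C :: "'v set"
  assumes "independent C"
  shows "finite C"
  using finite_dim real_vector.independent_span_bound[of _ C] assms by auto

text \<open>If some \<open>x\<close> in \<open>L\<close> is not orthogonal to \<open>c\<close>, then
  every vector of \<open>L\<close> differs from one in the hyperplane by a multiple of
  \<open>x\<close>.\<close>

lemma dim_le_hyperplane:
  assumes "subspace L"
  shows "dim L \<le> dim {v \<in> L. g v c = 0} + 1"
proof -
  let ?H = "{v \<in> L. g v c = 0}"
  obtain C where C: "C \<subseteq> ?H" "independent C" "?H \<subseteq> span C" "card C = dim ?H"
    using real_vector.basis_exists by blast
  note fin = finite_independent[OF C(2)]
  show ?thesis
  proof (cases "L \<subseteq> ?H")
    case True
    then have "?H = L" by auto
    then show ?thesis by simp
  next
    case False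
    then obtain x where x: "x \<in> L" "g x c \<noteq> 0" by blast
    have "v \<in> span (insert x C)" if "v \<in> L" for v
    proof -
      have "v - (g v c / g x c) *\<^sub>R x \<in> ?H"
        using that x assms by (simp add: subspace_diff subspace_scale g_simps)
      then show ?thesis
        using C by (auto simp: span_breakdown_eq)
    qed
    then have "dim L \<le> card (insert x C)"
      using fin by (intro real_vector.dim_le_card) auto
    also have "\<dots> \<le> card C + 1"
      by (simp add: card_insert_le_m1 fin card_insert_if)
    finally show ?thesis using C by simp
  qed
qed

lemma dim_le_complement:
  assumes "subspace L" "finite C"
  shows "dim L \<le> dim (L \<inter> g_complement g C) + card C"
  using assms(2)
proof (induction C)
  case empty
  then show ?case by (simp add: g_complement_def)
next
  case (insert c C)
  have "dim (L \<inter> g_complement g C) \<le> dim {v \<in> L \<inter> g_complement g C. g v c = 0} + 1"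
    by (intro dim_le_hyperplane subspace_inter assms g_complement_subspace g_bilinear)
  moreover have "{v \<in> L \<inter> g_complement g C. g v c = 0} = L \<inter> g_complement g (insert c C)"
    by (auto simp: g_complement_def)
  ultimately show ?case using insert by simp
qed

text \<open>One inequality counts the conditions imposed by a basis C of \<open>S\<close>. For the
  other, extend C to a basis D of the whole space: the card (D - C) further conditions cut the
  complement down to {0} by nondegeneracy. Null subspaces, which meet their complement, are covered
  too.\<close>

lemma dim_complement:
  assumes "subspace S"
  shows "dim S + dim (g_complement g S) = dim (UNIV :: 'v set)"
proof -
  obtain C where C: "C \<subseteq> S" "independent C" "S \<subseteq> span C" "card C = dim S"
    using real_vector.basis_exists by blast
  obtain D where D: "C \<subseteq> D" "independent D" "UNIV \<subseteq> span D"
    using real_vector.maximal_independent_subset_extend[of C UNIV] C by auto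
  note fin = finite_independent[OF C(2)] finite_independent[OF D(2)]
  have "span C = S"
    using C assms by (simp add: real_vector.span_subspace)
  then have SC: "g_complement g S = g_complement g C"
    using g_complement_span[OF g_bilinear] by metis
  have "g_complement g D = g_complement g UNIV"
    using g_complement_span[OF g_bilinear, of D] D(3) by (simp add: top.extremum_unique)
  then have "g_complement g D = {0}"
    using nondegenerate by (auto simp: g_complement_def g_simps g_sym)
  moreover have "g_complement g C \<inter> g_complement g (D - C) = g_complement g D"
    using D(1) by (auto simp: g_complement_def)
  ultimately have "dim (g_complement g C) \<le> card (D - C)"
    using dim_le_complement[OF g_complement_subspace[OF g_bilinear], of "D - C" C] fin
    using real_vector.dim_le_card[of "{0::'v}" "{}"] by simp
  moreover have "dim (UNIV :: 'v set) = card D"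
    using D real_vector.dim_eq_card[of D UNIV] by auto
  moreover have "dim (UNIV :: 'v set) \<le> dim (g_complement g C) + card C"
    using dim_le_complement[of UNIV C] fin by simp
  ultimately show ?thesis
    using C D(1) fin SC card_mono[OF fin(2) D(1)] by (simp add: card_Diff_subset)
qed

lemma dim_gt_one_not_subset_span:
  assumes "dim W > 1"
  obtains w where "w \<in> W" "w \<notin> span {k}"
proof -
  have "\<not> W \<subseteq> span {k}"
    using real_vector.dim_le_card[of W "{k}"] assms by auto
  then show thesis using that by blast
qed

section \<open>Existence of spacelike eigenvectors\<close>

text \<open>On \<open>W\<close> modulo \<open>K\<close> the form is positive definite, and a
  self-adjoint operator there has no rotation part. Used with \<open>K\<close> zero and with
  \<open>K\<close> spanned by a null vector.\<close>

lemma eigenvector_mod_radical: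
  assumes W: "subspace W" "invariant_under A W" and K: "subspace K"
    and orth: "\<And>k w. k \<in> K \<Longrightarrow> w \<in> W \<Longrightarrow> g k w = 0"
    and pos: "\<And>w. w \<in> W \<Longrightarrow> w \<notin> K \<Longrightarrow> g w w > 0"
    and "v \<in> W" "v \<notin> K"
  obtains u a where "u \<in> W" "u \<notin> K" "A u - a *\<^sub>R u \<in> K"
proof -
  obtain E where E: "finite E" "span E = (UNIV :: 'v set)"
    using finite_dim by blast
  show thesis
    using A_linear E W K \<open>v \<in> W\<close> \<open>v \<notin> K\<close>
  proof (cases rule: eigenvector_or_rotation_mod)
    case (eigenvector u a)
    then show thesis using that by blast
  next
    case (rotation u a b)
    define w where "w = A u - a *\<^sub>R u"
    have "w \<in> W"
      using rotation W by (simp add: w_def invariant_under_def subspace_diff subspace_scale)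
    then have "g w w \<ge> 0"
      using pos[of w] orth[of w w] by (cases "w \<in> K") auto
    moreover have "b\<^sup>2 * g u u > 0"
      using rotation pos by simp
    \<comment> \<open>The vector is (A - a)^2 u + b^2 u; self-adjointness moves one factor A - a
      across. The right side is positive, yet the vector lies in \<open>K\<close> and so is
      orthogonal to \<open>u\<close>.\<close>
    moreover have "g (A (A u) - (2 * a) *\<^sub>R A u + (a\<^sup>2 + b\<^sup>2) *\<^sub>R u) u = g w w + b\<^sup>2 * g u u"
      by (simp add: w_def g_simps self_adjoint power2_eq_square algebra_simps)
    ultimately show thesis
      using orth[OF rotation(4) rotation(1)] by linarith
  qed
qed

lemma eigenvector_of_positive:
  assumes W: "subspace W" "invariant_under A W"
    and pos: "\<And>w. w \<in> W \<Longrightarrow> w \<noteq> 0 \<Longrightarrow> g w w > 0"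
    and "dim W > 0"
  obtains u a where "u \<in> W" "g u u > 0" "A u = a *\<^sub>R u"
proof -
  have "\<not> W \<subseteq> {0}"
    using real_vector.dim_le_card[of W "{}"] \<open>dim W > 0\<close> by auto
  then obtain v where "v \<in> W" "v \<notin> {0}" by blast
  then show thesis
    using eigenvector_mod_radical[OF W subspace_single_0, of v] pos that
    by (auto simp: g_simps)
qed

text \<open>Vectors orthogonal to \<open>k\<close> but outside its span are spacelike, so the form
  is positive definite modulo \<open>k\<close>; the dimension bound makes this quotient
  nonzero.\<close>

lemma null_complement_eigenvector:
  assumes k: "k \<noteq> 0" "g k k = 0" "A k = a *\<^sub>R k"
    and L: "subspace L" "invariant_under A L"
    and dim: "dim {w \<in> L. g w k = 0} > 1"
  obtains u c where "u \<in> L" "g u k = 0" "g u u > 0" "A u - c *\<^sub>R u \<in> span {k}"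
proof -
  let ?W = "{w \<in> L. g w k = 0}"
  have W: "?W = L \<inter> g_complement g {k}"
    by (auto simp: g_complement_def)
  have inv: "invariant_under A ?W"
    using L(2) by (auto simp: invariant_under_def self_adjoint k(3) g_simps)
  have sub: "subspace ?W"
    using W L(1) g_complement_subspace[OF g_bilinear] by (auto intro: subspace_inter)
  have pos: "g w w > 0" if "w \<in> ?W" "w \<notin> span {k}" for w
    using that k pos_of_orthogonal[of k w] by (simp add: g_sym)
  obtain v where v: "v \<in> ?W" "v \<notin> span {k}"
    using dim_gt_one_not_subset_span[OF dim] .
  have orth: "g x w = 0" if "x \<in> span {k}" "w \<in> ?W" for x w
    using that by (auto simp: span_singleton g_simps g_sym)
  obtain u c where "u \<in> ?W" "u \<notin> span {k}" "A u - c *\<^sub>R u \<in> span {k}"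
    using eigenvector_mod_radical[OF sub inv subspace_span[of "{k}"] orth pos v] by blast
  then show thesis
    using that pos by blast
qed

text \<open>An eigenvector \<open>u\<close> modulo the null eigenvector \<open>k\<close> can be moved along \<open>k\<close> to a genuine
  one unless its eigenvalue coincides with that of \<open>k\<close>; two obstructed ones combine to a genuine one.\<close>

lemma null_complement_spacelike_eigenvector:
  assumes k: "k \<noteq> 0" "g k k = 0" "A k = a *\<^sub>R k" "k \<in> L"
    and L: "subspace L" "invariant_under A L" "dim L \<ge> 4"
  obtains u c where "u \<in> L" "g u u > 0" "A u = c *\<^sub>R u"
proof -
  note result = that
  have shift: thesis if u: "u \<in> L" "g u k = 0" "g u u > 0" "A u - c *\<^sub>R u = b *\<^sub>R k"
    and "b = 0 \<or> c \<noteq> a" for u b c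
  proof -
    \<comment> \<open>This solves (A - c)(u + s k) = (b + s a - c s) k = 0. If b = 0 then s = 0,
      also for c = a by the convention 0 / 0 = 0. The shift preserves the norm because
      \<open>k\<close> is null and orthogonal to \<open>u\<close>.\<close>
    define s where "s = b / (c - a)"
    have s: "b + s * a = c * s"
      using that(5) by (auto simp: s_def field_simps)
    have "A u = c *\<^sub>R u + b *\<^sub>R k"
      using u(4) by (simp add: algebra_simps)
    then have "A (u + s *\<^sub>R k) = c *\<^sub>R u + (b + s * a) *\<^sub>R k"
      by (simp add: A_simps k(3) algebra_simps)
    then have "A (u + s *\<^sub>R k) = c *\<^sub>R (u + s *\<^sub>R k)"
      by (simp only: s scaleR_add_right scaleR_scaleR)
    moreover have "g (u + s *\<^sub>R k) (u + s *\<^sub>R k) > 0"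
      using u k by (simp add: g_simps g_sym[of k u])
    moreover have "u + s *\<^sub>R k \<in> L"
      using u k L by (simp add: subspace_add subspace_scale)
    ultimately show thesis using result by blast
  qed
  have "dim {w \<in> L. g w k = 0} > 1"
    using dim_le_hyperplane[OF L(1), of k] L(3) by linarith
  then obtain u c where u: "u \<in> L" "g u k = 0" "g u u > 0" "A u - c *\<^sub>R u \<in> span {k}"
    using null_complement_eigenvector[OF k(1-3) L(1,2)] by blast
  then obtain b where b: "A u - c *\<^sub>R u = b *\<^sub>R k"
    by (auto simp: span_singleton)
  show thesis
  proof (cases "b = 0 \<or> c \<noteq> a")
    case True
    then show thesis using shift u b by blast
  next
    case False
    \<comment> \<open>\<open>L'\<close> is invariant because \<open>A\<close> maps the span of
      \<open>k\<close> and \<open>u\<close> to itself. At most two dimensions are lost, so at least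
      2 remain for a second search.\<close>
    define L' where "L' = {w \<in> {w \<in> L. g w k = 0}. g w u = 0}"
    have L'_eq: "L' = L \<inter> g_complement g {k, u}"
      by (auto simp: L'_def g_complement_def)
    have Au: "A u = a *\<^sub>R u + b *\<^sub>R k"
      using b False by (simp add: algebra_simps)
    have L': "subspace L'" "invariant_under A L'"
      using L g_complement_subspace[OF g_bilinear]
      by (auto simp: L'_eq subspace_inter)
        (auto simp: invariant_under_def g_complement_def self_adjoint k(3) Au g_simps)
    have "dim L \<le> dim L' + 2"
      using dim_le_complement[OF L(1), of "{k, u}"] unfolding L'_eq
      by (auto simp: card_insert_if split: if_splits)
    moreover have "{w \<in> L'. g w k = 0} = L'"
      by (auto simp: L'_def)
    ultimately have "dim {w \<in> L'. g w k = 0} > 1"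
      using L(3) by simp
    then obtain v d where v: "v \<in> L'" "g v k = 0" "g v v > 0" "A v - d *\<^sub>R v \<in> span {k}"
      using null_complement_eigenvector[OF k(1-3) L'] by blast
    then obtain e where e: "A v - d *\<^sub>R v = e *\<^sub>R k"
      by (auto simp: span_singleton)
    have vL: "v \<in> L" "g v u = 0"
      using v by (auto simp: L'_def)
    show thesis
    proof (cases "e = 0 \<or> d \<noteq> a")
      case True
      then show thesis using shift vL v e by blast
    next
      case False
      then have Av: "A v = a *\<^sub>R v + e *\<^sub>R k"
        using e by (simp add: algebra_simps)
      \<comment> \<open>The coefficients cancel the two multiples of \<open>k\<close>; orthogonality
        of \<open>u\<close> and \<open>v\<close> makes the result spacelike.\<close>
      let ?w = "e *\<^sub>R u - b *\<^sub>R v"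
      have "A ?w = a *\<^sub>R ?w"
        by (simp add: A_simps Au Av algebra_simps)
      moreover have "?w \<in> L"
        using vL u L by (simp add: subspace_diff subspace_scale)
      moreover have "g ?w ?w = e\<^sup>2 * g u u + b\<^sup>2 * g v v"
        using vL by (simp add: g_simps g_sym[of u v] power2_eq_square)
      moreover have "e\<^sup>2 * g u u + b\<^sup>2 * g v v > 0"
        using u v False by (simp add: add_pos_nonneg)
      ultimately show thesis using that by metis
    qed
  qed
qed

lemma spacelike_eigenvector:
  assumes L: "subspace L" "invariant_under A L" "dim L \<ge> 4"
  obtains u c where "u \<in> L" "g u u > 0" "A u = c *\<^sub>R u"
proof -
  obtain E where E: "finite E" "span E = (UNIV :: 'v set)"
    using finite_dim by blast
  have "dim L > 1" using L(3) by simp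
  then obtain v where "v \<in> L" "v \<notin> span {0}"
    using dim_gt_one_not_subset_span by blast
  then have v: "v \<in> L" "v \<notin> {0}"
    using span_zero by (blast, blast)
  from A_linear E L(1,2) subspace_single_0 v show thesis
  proof (cases rule: eigenvector_or_rotation_mod)
    case (eigenvector u a)
    then have u: "u \<in> L" "u \<noteq> 0" "A u = a *\<^sub>R u"
      by auto
    consider "g u u > 0" | "g u u = 0" | "g u u < 0" by linarith
    then show thesis
    proof cases
      case 1
      then show thesis using that u by blast
    next
      case 2
      then show thesis
        using null_complement_spacelike_eigenvector[of u a L] u L that by blast
    next
      case 3
      let ?W = "L \<inter> g_complement g {u}"
      have "dim ?W > 0"
        using dim_le_complement[OF L(1), of "{u}"] L(3) by simp
      moreover have "subspace ?W" "invariant_under A ?W"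
        using L(1,2) g_complement_subspace[OF g_bilinear]
        by (auto simp: subspace_inter)
          (auto simp: invariant_under_def g_complement_def self_adjoint u(3) g_simps)
      moreover have "g w w > 0" if "w \<in> ?W" "w \<noteq> 0" for w
      proof -
        have "g u w = 0"
          using that by (simp add: g_complement_def g_sym)
        moreover have "w \<notin> span {u}"
          using that 3 by (auto simp: span_singleton g_complement_def g_simps)
        ultimately show ?thesis
          using pos_of_orthogonal[of u w] u 3 by simp
      qed
      ultimately obtain w d where "w \<in> ?W" "g w w > 0" "A w = d *\<^sub>R w"
        using eigenvector_of_positive by metis
      then show thesis
        using that by blast
    qed
  next
    case (rotation u a b)
    \<comment> \<open>The vectors \<open>u\<close> and \<open>u'\<close> span the rotation plane: A
      - a sends \<open>u\<close> to \<open>u'\<close> and \<open>u'\<close> to -b^2 u.\<close>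
    define u' where "u' = A u - a *\<^sub>R u"
    have Au: "A u = u' + a *\<^sub>R u"
      by (simp add: u'_def)
    have Au': "A u' = a *\<^sub>R u' - b\<^sup>2 *\<^sub>R u"
    proof -
      have "A (A u) - (2 * a) *\<^sub>R A u + (a\<^sup>2 + b\<^sup>2) *\<^sub>R u = 0"
        using rotation by simp
      moreover have two: "(2 * a) *\<^sub>R x = a *\<^sub>R x + a *\<^sub>R x" for x :: 'v
        by (metis mult_2 scaleR_add_left)
      moreover have "A u' - (a *\<^sub>R u' - b\<^sup>2 *\<^sub>R u)
          = A (A u) - (2 * a) *\<^sub>R A u + (a\<^sup>2 + b\<^sup>2) *\<^sub>R u"
        unfolding two by (simp add: u'_def A_simps power2_eq_square algebra_simps)
      ultimately show ?thesis by simp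
    qed
    have "u \<noteq> 0" using rotation by simp
    have indep: "u' \<notin> span {u}"
    proof
      assume "u' \<in> span {u}"
      then obtain c where c: "u' = c *\<^sub>R u"
        by (auto simp: span_singleton)
      then have "(c * c + b\<^sup>2) *\<^sub>R u = 0"
        using Au' by (simp add: A_simps Au algebra_simps)
      moreover have "c * c + b\<^sup>2 > 0"
        using rotation by (simp add: add_nonneg_pos)
      ultimately show False using \<open>u \<noteq> 0\<close> by simp
    qed
    \<comment> \<open>By self-adjointness the norms of \<open>u\<close> and \<open>u'\<close> are
      either of opposite sign or both zero, so the plane is neither spacelike nor null and its
      complement is positive definite.\<close>
    have norm: "g u' u' = - (b\<^sup>2 * g u u)"
    proof -
      have "g u' (A u) = g (A u') u"
        by (simp add: self_adjoint)
      then show ?thesis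
        by (simp add: Au Au' g_simps)
    qed
    let ?W = "L \<inter> g_complement g {u, u'}"
    have "dim ?W > 0"
    proof -
      have "card {u, u'} \<le> 2"
        by (simp add: card_insert_if)
      then show ?thesis
        using dim_le_complement[OF L(1), of "{u, u'}"] L(3) by simp
    qed
    moreover have "subspace ?W" "invariant_under A ?W"
      using L(1,2) g_complement_subspace[OF g_bilinear]
      by (auto simp: subspace_inter)
        (auto simp: invariant_under_def g_complement_def self_adjoint Au Au' g_simps)
    moreover have "g w w > 0" if w: "w \<in> ?W" "w \<noteq> 0" for w
    proof -
      have orth: "g u w = 0" "g u' w = 0"
        using w by (simp_all add: g_complement_def g_sym)
      have "u' \<noteq> 0" using indep span_zero by metis
      consider "g u u > 0" | "g u u < 0" | "g u u = 0" by linarith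
      then show ?thesis
      proof cases
        case 1
        then have "g u' u' < 0" using norm rotation by simp
        moreover then have "w \<notin> span {u'}"
          using w orth by (auto simp: span_singleton g_simps)
        ultimately show ?thesis
          using pos_of_orthogonal[of u' w] orth \<open>u' \<noteq> 0\<close> by simp
      next
        case 2
        moreover then have "w \<notin> span {u}"
          using w orth by (auto simp: span_singleton g_simps)
        ultimately show ?thesis
          using pos_of_orthogonal[of u w] orth \<open>u \<noteq> 0\<close> by simp
      next
        case 3
        \<comment> \<open>Both vectors are null here; if they were orthogonal, \<open>u'\<close>
          would be spacelike.\<close>
        have "g u u' \<noteq> 0"
          using pos_of_orthogonal[of u u'] indep \<open>u \<noteq> 0\<close> 3 norm by auto
        then have "w \<notin> span {u}"
          using w orth by (auto simp: span_singleton g_simps g_sym)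
        then show ?thesis
          using pos_of_orthogonal[of u w] orth \<open>u \<noteq> 0\<close> 3 by simp
      qed
    qed
    ultimately obtain w d where "w \<in> ?W" "g w w > 0" "A w = d *\<^sub>R w"
      using eigenvector_of_positive by metis
    then show thesis
      using that by blast
  qed
qed

section \<open>Causal character of subspaces\<close>

text \<open>Choose a nonzero \<open>x\<close> in the subspace orthogonal to \<open>z\<close>; it is
  spacelike. With s^2 g(z,z) = -g(x,x), the vectors s z + x and s z - x span two distinct null
  directions.\<close>

lemma timelike_subspace_of_vector:
  assumes N: "subspace N" "dim N \<ge> 2" and z: "z \<in> N" "g z z < 0"
  shows "timelike_subspace g N"
proof -
  have "dim {v \<in> N. g v z = 0} > 0"
    using dim_le_hyperplane[OF N(1), of z] N(2) by linarith
  then have "\<not> {v \<in> N. g v z = 0} \<subseteq> {0}"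
    using real_vector.dim_le_card[of "{v \<in> N. g v z = 0}" "{}"] by auto
  then obtain x where x: "x \<in> N" "g x z = 0" "x \<noteq> 0" by blast
  have "x \<notin> span {z}"
    using x z by (auto simp: span_singleton g_simps)
  moreover have "z \<noteq> 0"
    using z by (auto simp: g_simps)
  ultimately have xx: "g x x > 0"
    using pos_of_orthogonal[of z x] x z by (simp add: g_sym)
  define s where "s = sqrt (g x x / - g z z)"
  have "s\<^sup>2 = g x x / - g z z"
    unfolding s_def using xx z by (intro real_sqrt_pow2 divide_nonneg_pos) auto
  then have s: "s * s * g z z = - g x x"
    using z by (simp add: power2_eq_square field_simps)
  let ?p = "s *\<^sub>R z + x" and ?q = "s *\<^sub>R z - x"
  have "s \<noteq> 0" using s xx by auto
  have ng: "?p \<notin> span {?q}"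
  proof
    assume "?p \<in> span {?q}"
    then obtain c where c: "?p = c *\<^sub>R ?q"
      by (auto simp: span_singleton)
    \<comment> \<open>Pairing with \<open>z\<close> forces c = 1, pairing with \<open>x\<close>
      forces c = -1.\<close>
    have "g ?p z = s * g z z" "g (c *\<^sub>R ?q) z = c * (s * g z z)"
      "g ?p x = g x x" "g (c *\<^sub>R ?q) x = - (c * g x x)"
      using x by (simp_all add: g_simps g_sym[of z x])
    then have "c = 1" "c = - 1"
      using c xx z \<open>s \<noteq> 0\<close> by (auto simp: mult_eq_1_iff)
    then show False by simp
  qed
  have "?p \<noteq> 0"
    using ng span_zero by metis
  moreover have "?q \<noteq> 0"
  proof
    assume "?q = 0"
    then have "g ?q x = 0" by (simp only: g_simps)
    then show False using x xx by (simp add: g_simps g_sym[of z x])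
  qed
  moreover have "g ?p ?p = 0" "g ?q ?q = 0"
    using s x by (simp_all add: g_simps g_sym[of z x] algebra_simps)
  moreover have "?p \<in> N" "?q \<in> N"
    using N x z by (simp_all add: subspace_add subspace_diff subspace_scale)
  moreover have "span {?p} \<noteq> span {?q}"
    using ng span_base by blast
  ultimately show ?thesis
    using N unfolding timelike_subspace_def null_directions_def null_vector_def by blast
qed

text \<open>A vector orthogonal to the null vector \<open>k\<close> and not a multiple of it is
  spacelike, so \<open>k\<close> gives the only null direction.\<close>

lemma null_subspace_of_orthogonal:
  assumes N: "subspace N" "dim N \<ge> 2" and k: "k \<in> N" "k \<noteq> 0" "g k k = 0"
    and orth: "\<And>w. w \<in> N \<Longrightarrow> g k w = 0"
  shows "null_subspace g N"
proof -
  have "span {v} = span {k}" if v: "v \<in> N" "v \<noteq> 0" "g v v = 0" for v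
  proof -
    have "v \<in> span {k}"
      using pos_of_orthogonal[of k v] k orth v by fastforce
    then obtain c where c: "v = c *\<^sub>R k"
      by (auto simp: span_singleton)
    with v have "c \<noteq> 0" by auto
    then show ?thesis
      using span_image_scale[of "{k}" "\<lambda>_. c"] by (simp add: c)
  qed
  then have "null_directions g N = {span {k}}"
    using k unfolding null_directions_def null_vector_def by blast
  then show ?thesis
    using N by (auto simp: null_subspace_def)
qed

lemma null_subspace_null_eigenvector:
  assumes N: "null_subspace g N" and inv: "invariant_under A N"
  obtains k where "k \<in> N" "null_eigenvector g A k"
proof -
  have sub: "subspace N"
    using N by (simp add: null_subspace_def)
  obtain k where k: "k \<in> N" "k \<noteq> 0" "g k k = 0"
    and uniq: "\<And>v. v \<in> N \<Longrightarrow> g v v = 0 \<Longrightarrow> v \<in> span {k}"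
  proof (cases "\<exists>v. N = span {v} \<and> null_vector g v")
    case True
    then show thesis
      using that by (metis null_vector_def insertI1 span_base)
  next
    case False
    then obtain L where L: "L \<in> null_directions g N"
      "\<And>L'. L' \<in> null_directions g N \<Longrightarrow> L' = L"
      using N by (auto simp: null_subspace_def)
    from L(1) obtain k where k: "k \<in> N" "null_vector g k" "L = span {k}"
      unfolding null_directions_def by blast
    have "v \<in> span {k}" if "v \<in> N" "g v v = 0" for v
    proof (cases "v = 0")
      case True
      then show ?thesis by (simp add: span_zero)
    next
      case False
      then have "span {v} = L"
        using that by (intro L) (auto simp: null_directions_def null_vector_def)
      then show ?thesis
        using k span_base by blast
    qed
    then show thesis
      using that k by (simp add: null_vector_def)
  qed
  have orth: "g k w = 0" if w: "w \<in> N" for w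
  proof (rule ccontr)
    assume kw: "g k w \<noteq> 0"
    have "w \<notin> span {k}"
      using kw k by (auto simp: span_singleton g_simps)
    then have ww: "g w w \<noteq> 0"
      using uniq w by blast
    \<comment> \<open>The nonzero root of g(k + s w, k + s w) = s (2 g(k,w) + s g(w,w)); it would
      give a second null direction.\<close>
    define s where "s = - (2 * g k w) / g w w"
    have "s * g w w = - (2 * g k w)"
      using ww by (simp add: s_def)
    then have "2 * g k w + s * g w w = 0" by simp
    then have "s * (2 * g k w + s * g w w) = 0" by simp
    then have "g (k + s *\<^sub>R w) (k + s *\<^sub>R w) = 0"
      using k by (simp add: g_simps g_sym[of w k] algebra_simps)
    then have "k + s *\<^sub>R w \<in> span {k}"
      using k w sub by (intro uniq) (simp_all add: subspace_add subspace_scale)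
    then have "s *\<^sub>R w \<in> span {k}"
      by (metis add_diff_cancel_left' insertI1 span_base span_diff)
    then have "inverse s *\<^sub>R (s *\<^sub>R w) \<in> span {k}"
      by (rule span_scale)
    moreover have "s \<noteq> 0"
      using ww kw by (simp add: s_def)
    ultimately have "w \<in> span {k}"
      by simp
    then show False using \<open>w \<notin> span {k}\<close> by blast
  qed
  \<comment> \<open>Hence g(A k, A k) = g(k, A (A k)) = 0, and uniqueness of the null direction
    makes A k a multiple of \<open>k\<close>.\<close>
  have "A k \<in> N" "A (A k) \<in> N"
    using inv k by (auto simp: invariant_under_def)
  then have "A k \<in> span {k}"
    using uniq orth by (simp add: self_adjoint)
  then have "null_eigenvector g A k"
    using k by (auto simp: null_eigenvector_def null_vector_def span_singleton)
  then show thesis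
    using that k by blast
qed

section \<open>Construction of invariant subspaces\<close>

text \<open>Dimension 5 leaves dimension at least 4 in the complement of the first spacelike
  eigenvector, enough to find a second one there.\<close>

lemma spacelike_invariant_plane:
  assumes "dim (UNIV :: 'v set) \<ge> 5"
  obtains W where "spacelike_subspace g W" "dim W = 2" "invariant_under A W"
    "timelike_subspace g (g_complement g W)"
proof -
  obtain u c where u: "g u u > 0" "A u = c *\<^sub>R u"
    using spacelike_eigenvector[of UNIV] assms by (auto simp: invariant_under_def)
  let ?L = "g_complement g {u}"
  have "dim ?L \<ge> 4"
    using dim_le_complement[of UNIV "{u}"] assms by simp
  moreover have "invariant_under A ?L"
    by (auto simp: invariant_under_def g_complement_def self_adjoint u(2) g_simps)
  ultimately obtain v d where v: "v \<in> ?L" "g v v > 0" "A v = d *\<^sub>R v"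
    using spacelike_eigenvector[OF g_complement_subspace[OF g_bilinear]] by blast
  have uv: "g u v = 0" "g v u = 0"
    using v(1) by (simp_all add: g_complement_def g_sym)
  let ?W = "span {u, v}"
  have W: "\<exists>x y. w = x *\<^sub>R u + y *\<^sub>R v" if w: "w \<in> ?W" for w
  proof -
    obtain x where "w - x *\<^sub>R u \<in> span {v}"
      using w real_vector.span_breakdown_eq[of w u "{v}"] by blast
    then obtain y where "w - x *\<^sub>R u = y *\<^sub>R v"
      by (auto simp: span_singleton)
    then show ?thesis
      by (metis add.commute diff_add_cancel)
  qed
  have mem: "u \<in> ?W" "v \<in> ?W"
    by (simp_all add: span_base)
  have pos: "g w w > 0" if "w \<in> ?W" "w \<noteq> 0" for w
  proof -
    from W[OF that(1)] obtain x y where w: "w = x *\<^sub>R u + y *\<^sub>R v"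
      by blast
    then have "x \<noteq> 0 \<or> y \<noteq> 0" using that by auto
    then have "x\<^sup>2 * g u u + y\<^sup>2 * g v v > 0"
      using u v by (auto intro: add_pos_nonneg add_nonneg_pos)
    then show ?thesis
      by (simp add: w g_simps uv power2_eq_square)
  qed
  have "u \<notin> span {v}"
    using u uv by (auto simp: span_singleton g_simps)
  moreover have "u \<noteq> v" "v \<noteq> 0"
    using u v uv by (auto simp: g_simps)
  ultimately have "independent {u, v}"
    by (simp add: independent_insert)
  then have dim: "dim ?W = 2"
    using real_vector.dim_eq_card_independent[of "{u, v}"] \<open>u \<noteq> v\<close> by simp
  have "null_directions g ?W = {}"
    using pos by (fastforce simp: null_directions_def null_vector_def)
  then have "spacelike_subspace g ?W"
    using dim by (simp add: spacelike_subspace_def)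
  moreover have "invariant_under A ?W"
  proof (unfold invariant_under_def, intro ballI)
    fix w assume "w \<in> ?W"
    then obtain x y where "w = x *\<^sub>R u + y *\<^sub>R v"
      using W by blast
    then show "A w \<in> ?W"
      using mem by (simp add: A_simps u(2) v(3) span_add span_scale)
  qed
  moreover have "timelike_subspace g (g_complement g ?W)"
  proof -
    obtain t where t: "g t t < 0"
      using timelike_exists by blast
    \<comment> \<open>The orthogonal projection of the timelike \<open>t\<close> to the plane. As
      g(w,w) is nonnegative, t - w is a timelike vector of the complement.\<close>
    define w where "w = (g t u / g u u) *\<^sub>R u + (g t v / g v v) *\<^sub>R v"
    have wW: "w \<in> ?W"
      using mem by (simp add: w_def span_add span_scale)
    have "t - w \<in> g_complement g {u, v}"
      using u v uv by (simp add: g_complement_def w_def g_simps)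
    then have z: "t - w \<in> g_complement g ?W"
      by (simp add: g_complement_span[OF g_bilinear])
    then have "g (t - w) w = 0"
      using wW by (simp add: g_complement_def)
    moreover have "g w w \<ge> 0"
      using pos[OF wW] by (cases "w = 0") (auto simp: g_simps)
    ultimately have "g (t - w) (t - w) < 0"
      using t by (simp add: g_simps g_sym[of w t])
    moreover have "dim (g_complement g ?W) \<ge> 2"
      using dim_complement[of ?W] dim assms by simp
    ultimately show ?thesis
      using timelike_subspace_of_vector[OF g_complement_subspace[OF g_bilinear]] z by blast
  qed
  ultimately show thesis using that dim by blast
qed

lemma null_eigenvector_null_subspace:
  assumes k: "null_eigenvector g A k"
    and r: "r \<in> {2, dim (UNIV :: 'v set) - 2, dim (UNIV :: 'v set) - 1}"
    and dim: "dim (UNIV :: 'v set) \<ge> 4"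
  obtains N where "null_subspace g N" "dim N = r" "invariant_under A N"
proof -
  obtain a where k: "k \<noteq> 0" "g k k = 0" "A k = a *\<^sub>R k"
    using k by (auto simp: null_eigenvector_def null_vector_def)
  have "dim {w \<in> UNIV. g w k = 0} > 1"
    using dim_le_hyperplane[of UNIV k] dim by simp
  then obtain u c where u: "g u k = 0" "g u u > 0" "A u - c *\<^sub>R u \<in> span {k}"
    using null_complement_eigenvector[OF k, of UNIV] by (auto simp: invariant_under_def)
  then obtain b where "A u - c *\<^sub>R u = b *\<^sub>R k"
    by (auto simp: span_singleton)
  then have Au: "A u = c *\<^sub>R u + b *\<^sub>R k"
    by (simp add: algebra_simps)
  have ku: "g k u = 0"
    using u by (simp add: g_sym)
  let ?K = "span {k}" and ?N = "span {u, k}"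
  have "u \<notin> span {k}"
    using u k by (auto simp: span_singleton g_simps)
  moreover then have "u \<noteq> k"
    using span_base by blast
  ultimately have "independent {u, k}"
    using k by (simp add: independent_insert)
  then have dimN: "dim ?N = 2"
    using real_vector.dim_eq_card_independent[of "{u, k}"] \<open>u \<noteq> k\<close> by simp
  have dimK: "dim ?K = 1"
    using real_vector.dim_eq_card_independent[of "{k}"] k by simp
  have comp: "g_complement g ?N = g_complement g {u, k}" "g_complement g ?K = g_complement g {k}"
    by (simp_all add: g_complement_span[OF g_bilinear])
  have invK: "invariant_under A ?K"
    by (auto simp: invariant_under_def span_singleton A_simps k(3))
  have mem: "u \<in> ?N" "k \<in> ?N"
    by (simp_all add: span_base)
  have invN: "invariant_under A ?N"
  proof (unfold invariant_under_def, intro ballI)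
    fix w assume "w \<in> ?N"
    then show "A w \<in> ?N"
    proof (induction rule: span_induct_alt)
      case base
      then show ?case by (simp add: A_simps span_zero)
    next
      case (step s x y)
      then show ?case
        using mem by (auto simp: A_simps k(3) Au span_add span_scale)
    qed
  qed
  have kN: "k \<in> g_complement g ?N" "k \<in> g_complement g ?K"
    unfolding comp using k ku by (simp_all add: g_complement_def)
  from r consider "r = 2" | "r = dim (UNIV :: 'v set) - 2" | "r = dim (UNIV :: 'v set) - 1"
    by auto
  then show thesis
  proof cases
    case 1
    have "null_subspace g ?N"
      using dimN mem k kN by (intro null_subspace_of_orthogonal[of _ k]) (auto simp: g_complement_def)
    then show thesis
      using that[of ?N] 1 dimN invN by simp
  next
    case 2
    have d: "dim (g_complement g ?N) = r"
      using dim_complement[of ?N] dimN 2 by simp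
    have "null_subspace g (g_complement g ?N)"
      using d dim 2 kN k unfolding comp
      by (intro null_subspace_of_orthogonal[of _ k] g_complement_subspace g_bilinear)
        (auto simp: g_complement_def g_sym)
    then show thesis
      using that d complement_invariant[OF invN] by blast
  next
    case 3
    have d: "dim (g_complement g ?K) = r"
      using dim_complement[of ?K] dimK 3 by simp
    have "null_subspace g (g_complement g ?K)"
      using d dim 3 kN k unfolding comp
      by (intro null_subspace_of_orthogonal[of _ k] g_complement_subspace g_bilinear)
        (auto simp: g_complement_def g_sym)
    then show thesis
      using that d complement_invariant[OF invK] by blast
  qed
qed

end

section \<open>The mixed form of a symmetric tensor\<close>

lemma lorentz_self_adjoint_mixed_form:
  fixes g T :: "'v::real_vector \<Rightarrow> 'v \<Rightarrow> real"
  assumes dim: "dim (UNIV :: 'v set) > 0" and g: "lorentzian g" and T: "symmetric_form T"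
  shows "lorentz_self_adjoint g (mixed_form g T)"
proof -
  obtain t B where tB: "t \<notin> B" "independent (insert t B)" "span (insert t B) = UNIV"
    and tt: "g t t = - 1" and norm: "\<forall>x\<in>B. g x x = 1"
    and orthogonal: "\<forall>x\<in>insert t B. \<forall>y\<in>insert t B. x \<noteq> y \<longrightarrow> g x y = 0"
    using g unfolding lorentzian_def by (elim conjE exE)
  note bb = bspec[OF norm] and orth = mp[OF bspec[OF bspec[OF orthogonal]]]
  have bil: "bilinear g" and sym: "g u v = g v u" for u v
    using g by (auto simp: lorentzian_def symmetric_form_def)
  have linL: "linear (\<lambda>x. g x y)" and linR: "linear (g y)" for y
    using bil by (auto simp: bilinear_def)
  note gs = bilinear_ladd[OF bil] bilinear_radd[OF bil] bilinear_lsub[OF bil]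
    bilinear_rsub[OF bil] bilinear_lmul[OF bil] bilinear_rmul[OF bil]
    bilinear_lzero[OF bil] bilinear_rzero[OF bil]
  have "card (insert t B) = dim (UNIV :: 'v set)"
    using real_vector.dim_eq_card[of "insert t B" UNIV] tB by auto
  \<comment> \<open>An infinite basis would have \<open>card\<close> 0, against the positive
    dimension.\<close>
  then have fin: "finite (insert t B)"
    using dim card_gt_0_iff by metis
  have coord: "(\<Sum>c\<in>B. f c * g b c) = f b" if "b \<in> B" for f b
  proof -
    have "(\<Sum>c\<in>B. f c * g b c) = (\<Sum>c\<in>B. if c = b then f b else 0)"
      using that by (intro sum.cong) (auto simp: bb orth)
    then show ?thesis
      using that fin by simp
  qed
  have pos: "g x x > 0" if x: "x \<in> span B" "x \<noteq> 0" for x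
  proof -
    obtain f where f: "x = (\<Sum>b\<in>B. f b *\<^sub>R b)"
      using x fin by (auto simp: span_finite)
    have "g b x = f b" if "b \<in> B" for b
      using coord[OF that] by (simp add: f linear_sum[OF linR] gs)
    moreover have "g x x = (\<Sum>b\<in>B. f b * g b x)"
      by (subst (1) f) (simp add: linear_sum[OF linL] gs)
    ultimately have eq: "g x x = (\<Sum>b\<in>B. (f b)\<^sup>2)"
      by (simp add: power2_eq_square)
    obtain b where "b \<in> B" "f b \<noteq> 0"
      using x f by (metis (no_types, lifting) scale_zero_left sum.neutral)
    then show ?thesis
      unfolding eq using fin by (intro sum_pos2[of _ b]) auto
  qed
  have tB0: "g t y = 0" "g y t = 0" if "y \<in> span B" for y
  proof -
    have "t \<in> g_complement g B"
      using orth tB by (auto simp: g_complement_def)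
    then have "t \<in> g_complement g (span B)"
      by (simp only: g_complement_span[OF bil])
    then show "g t y = 0"
      using that by (simp add: g_complement_def)
    then show "g y t = 0" by (simp add: sym)
  qed
  have pos_orth: "g w w > 0"
    if "u \<noteq> 0" "g u u \<le> 0" "g u w = 0" "w \<notin> span {u}" for u w
  proof -
    obtain a where a: "u - a *\<^sub>R t \<in> span B"
      using tB(3) span_breakdown_eq by blast
    obtain b where b: "w - b *\<^sub>R t \<in> span B"
      using tB(3) span_breakdown_eq by blast
    have "a \<noteq> 0"
      using pos[of u] a that by auto
    \<comment> \<open>Subtracting this multiple of \<open>u\<close> removes the \<open>t\<close>
      component, so g(z,z) > 0; and g(z,z) is at most g(w,w) because \<open>u\<close> is orthogonal
      to \<open>w\<close> and not spacelike.\<close>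
    define z where "z = w - (b / a) *\<^sub>R u"
    have "z = (w - b *\<^sub>R t) - (b / a) *\<^sub>R (u - a *\<^sub>R t)"
      using \<open>a \<noteq> 0\<close> by (simp add: z_def algebra_simps)
    then have "z \<in> span B"
      using a b span_diff span_scale by metis
    moreover have "z \<noteq> 0"
      using that by (auto simp: z_def span_singleton)
    ultimately have "g z z > 0"
      using pos by blast
    moreover have "g z z = g w w + (b / a)\<^sup>2 * g u u"
      using that by (simp add: z_def gs sym[of w u] power2_eq_square)
    moreover have "(b / a)\<^sup>2 * g u u \<le> 0"
      using that by (simp add: mult_nonneg_nonpos)
    ultimately show ?thesis by linarith
  qed
  \<comment> \<open>Surjectivity onto linear functionals ensures that the \<open>inv\<close> in
    \<open>raise_index\<close> returns a true preimage.\<close>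
  have riesz: "f \<in> range (lower_index g)" if f: "linear f" for f :: "'v \<Rightarrow> real"
  proof -
    \<comment> \<open>The sign of the \<open>t\<close> term compensates g(t,t) = -1.\<close>
    define w where "w = (\<Sum>b\<in>B. f b *\<^sub>R b) - f t *\<^sub>R t"
    have gsum: "g x w = (\<Sum>b\<in>B. f b * g x b) - f t * g x t" for x
      by (simp add: w_def gs linear_sum[OF linR])
    have "g x w = f x" if "x \<in> insert t B" for x
    proof (cases "x = t")
      case True
      have "(\<Sum>b\<in>B. f b * g t b) = 0"
        by (intro sum.neutral) (use tB0 span_base in auto)
      then show ?thesis by (simp add: gsum True tt)
    next
      case False
      then show ?thesis
        using that by (simp add: gsum coord orth)
    qed
    then have "g x w = f x" for x
      using linear_eq_on_span[OF linL f, of "insert t B"] tB(3) by blast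
    then show ?thesis
      by (auto simp: lower_index_def intro!: image_eqI[of _ _ w])
  qed
  have mixed: "g u (mixed_form g T v) = T u v" for u v
  proof -
    have "linear (\<lambda>u. T u v)"
      using T by (simp add: symmetric_form_def bilinear_def)
    from f_inv_into_f[OF riesz[OF this]]
    have "lower_index g (mixed_form g T v) = (\<lambda>u. T u v)"
      by (simp add: mixed_form_def raise_index_def)
    then show ?thesis
      by (simp add: lower_index_def fun_eq_iff)
  qed
  have T_sym: "T u v = T v u" for u v
    using T by (simp add: symmetric_form_def)
  show ?thesis
  proof
    show "bilinear g" by (rule bil)
    show "g u v = g v u" for u v by (rule sym)
    show "\<exists>E. finite E \<and> span E = (UNIV :: 'v set)" using fin tB by blast
    show "\<exists>t. g t t < 0" using tt by (intro exI[of _ t]) simp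
    show "g (mixed_form g T u) v = g u (mixed_form g T v)" for u v
      using mixed sym T_sym by metis
  qed (rule pos_orth)
qed

theorem theorem3:
  fixes g T :: "'v::real_vector \<Rightarrow> 'v \<Rightarrow> real"
  assumes "dim (UNIV :: 'v set) = 5"
    and "lorentzian g"
    and "symmetric_form T"
  shows "(\<exists>W. spacelike_subspace g W \<and> dim W = 2 \<and> invariant_under (mixed_form g T) W) \<and>
    (\<forall>V. non_null_subspace g V \<and> invariant_under (mixed_form g T) V \<longrightarrow>
      invariant_under (mixed_form g T) (g_complement g V)) \<and>
    (\<exists>W. timelike_subspace g W \<and> dim W = 3 \<and> invariant_under (mixed_form g T) W) \<and>
    (\<forall>r\<in>{2, 3, 4}.
      ((\<exists>N. null_subspace g N \<and> dim N = r \<and> invariant_under (mixed_form g T) N) \<longleftrightarrow>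
        (\<exists>v. null_eigenvector g (mixed_form g T) v)) \<and>
      (\<forall>N. null_subspace g N \<and> dim N = r \<and> invariant_under (mixed_form g T) N \<longrightarrow>
        (\<exists>v\<in>N. null_eigenvector g (mixed_form g T) v)))"
proof -
  interpret lorentz_self_adjoint g "mixed_form g T"
    using assms by (intro lorentz_self_adjoint_mixed_form) auto
  obtain W where W: "spacelike_subspace g W" "dim W = 2" "invariant_under (mixed_form g T) W"
    "timelike_subspace g (g_complement g W)"
    using spacelike_invariant_plane assms(1) by auto
  have "dim (g_complement g W) = 3"
    using dim_complement[of W] W assms(1) by (simp add: spacelike_subspace_def)
  moreover have "\<exists>N. null_subspace g N \<and> dim N = r \<and> invariant_under (mixed_form g T) N"
    if "null_eigenvector g (mixed_form g T) v" "r \<in> {2, 3, 4}" for v and r :: nat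
    using null_eigenvector_null_subspace[OF that(1), of r] that(2) assms(1) by auto
  moreover have "\<exists>v\<in>N. null_eigenvector g (mixed_form g T) v"
    if "null_subspace g N" "invariant_under (mixed_form g T) N" for N
    using null_subspace_null_eigenvector[OF that] by blast
  ultimately show ?thesis
    using W complement_invariant by (intro conjI allI impI ballI iffI; blast)
qed

end
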